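(* Let $m>n\ge2$ and $k\ge2$ be integers. The following are equivalent: (1) $\mathsf{lim}_k\le_{\mathrm W}(\mathsf{PHP}^m_n)'$; (2) $\mathsf{lim}_k\le_{\mathrm{sW}}(\mathsf{PHP}^m_n)'$; (3) $\mathsf{lim}_k\le^*_{\mathrm{sW}}(\mathsf{PHP}^m_n)'$; (4) $\mathsf{id}_k\le^*_{\mathrm{sW}}\mathsf{PHP}^m_n$; (5) $\mathsf{id}_k\le\mathsf{PHP}^m_n$; (6) $\mathsf{id}_k\le_{\mathrm{sW}}\mathsf{PHP}^m_n$. Moreover, for integers $m_0>n_0\ge2$ and $m_1>n_1\ge2$, $\mathsf{PHP}^{m_0}_{n_0}\le\mathsf{PHP}^{m_1}_{n_1}$ if and only if $(\mathsf{PHP}^{m_0}_{n_0})'\le_{\mathrm W}(\mathsf{PHP}^{m_1}_{n_1})'$.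
   Context: A number $N\ge1$ is identified with $\{0,\dots,N-1\}$. A problem $\mathsf{P}$ consists of a nonempty set of instances and, for each instance $x$, a nonempty set $\mathsf{P}(x)$ of solutions; instances and solutions are coded as elements of Baire space $\mathbb N^{\mathbb N}$ (finite objects, finite tuples, functions between finite sets, and sequences of such are coded in a standard way). For finite problems (finitely many instances, each with finitely many solutions, all coded by natural numbers), $\mathsf{P}\le\mathsf{Q}$ means there exist a map $\Phi$ sending each $\mathsf{P}$-instance $x$ to a $\mathsf{Q}$-instance and a (partial) map $\Psi$ on $\mathsf{Q}$-solutions with $\Psi(y)\in\mathsf{P}(x)$ whenever $y\in\mathsf{Q}(\Phi(x))$. For general problems: $\mathsf{P}\le_{\mathrm{sW}}\mathsf{Q}$ (strong Weihrauch reducibility) if there are Turing functionals (effectively continuous partial maps on $\mathbb N^{\mathbb N}$) $\Phi,\Psi$ such that for every $\mathsf{P}$-instance $p$, $\Phi(p)$ is a $\mathsf{Q}$-instance and for every $\mathsf{Q}$-solution $q$ of $\Phi(p)$, $\Psi(q)$ is a $\mathsf{P}$-solution of $p$; $\le^*_{\mathrm{sW}}$ is the same with $\Phi,\Psi$ merely continuous (for the Baire topology); $\mathsf{P}\le_{\mathrm W}\mathsf{Q}$ (Weihrauch reducibility) is the same as $\le_{\mathrm{sW}}$ except that $\Psi$ takes the pair $(p,q)$ as input. For $m>n\ge2$, $\mathsf{PHP}^m_n$ has as instances all functions $f:m\to n$, with solutions all unordered pairs $\{i,j\}$, $i\ne j$, $f(i)=f(j)$. Its jump $(\mathsf{PHP}^m_n)'$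 has as instances all pointwise convergent sequences $(f_s:m\to n)_{s\in\mathbb N}$, with solutions all $\{i,j\}$, $i\ne j$, with $\lim_s f_s(i)=\lim_s f_s(j)$. For $k\ge1$, $\mathsf{id}_k$ has instances $j\in\{1,\dots,k\}$ with unique solution $j$. For $k\ge2$, $\mathsf{lim}_k$ has as instances all convergent sequences of numbers $<k$, with unique solution the limit. *)

theory Defs
  imports "HOL-Analysis.Analysis" "HOL-Library.Nat_Bijection" "HOL-Library.FuncSet"
begin

section \<open>Problems\<close>

record ('a, 'b) problem =
  instances :: "'a set"
  solutions :: "'a \<Rightarrow> 'b set"

definition is_problem :: "('a, 'b) problem \<Rightarrow> bool" where
  "is_problem P \<longleftrightarrow> instances P \<noteq> {} \<and> (\<forall>x\<in>instances P. solutions P x \<noteq> {})"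

definition is_finite_problem :: "('a, 'b) problem \<Rightarrow> bool" where
  "is_finite_problem P \<longleftrightarrow>
     is_problem P \<and> finite (instances P) \<and> (\<forall>x\<in>instances P. finite (solutions P x))"

definition PHP :: "nat \<Rightarrow> nat \<Rightarrow> (nat \<Rightarrow> nat, nat set) problem" where
  "PHP m n =
     \<lparr>instances = {..<m} \<rightarrow>\<^sub>E {..<n},
      solutions = (\<lambda>f. {{i, j} | i j. i < m \<and> j < m \<and> i \<noteq> j \<and> f i = f j})\<rparr>"

definition PHP_jump :: "nat \<Rightarrow> nat \<Rightarrow> (nat \<Rightarrow> nat \<Rightarrow> nat, nat set) problem" where
  "PHP_jump m n =
     \<lparr>instances = {f. (\<forall>s. f s \<in> {..<m} \<rightarrow>\<^sub>E {..<n}) \<and> (\<forall>i<m. convergent (\<lambda>s. f s i))},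
      solutions = (\<lambda>f. {{i, j} | i j. i < m \<and> j < m \<and> i \<noteq> j \<and>
                                     lim (\<lambda>s. f s i) = lim (\<lambda>s. f s j)})\<rparr>"

definition id_problem :: "nat \<Rightarrow> (nat, nat) problem" where
  "id_problem k = \<lparr>instances = {1..k}, solutions = (\<lambda>j. {j})\<rparr>"

definition lim_problem :: "nat \<Rightarrow> (nat \<Rightarrow> nat, nat) problem" where
  "lim_problem k =
     \<lparr>instances = {p. (\<forall>s. p s < k) \<and> convergent p}, solutions = (\<lambda>p. {lim p})\<rparr>"


section \<open>Coding in Baire space\<close>

type_synonym baire = "nat \<Rightarrow> nat"

text \<open>\<open>coded c d P\<close> is the problem \<open>P\<close> with every instance \<open>x\<close> replaced by its code \<open>c x\<close> and every
  solution \<open>y\<close> by its code \<open>d y\<close>; it is meant for \<open>c\<close> and \<open>d\<close> that are injective on the instances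
  and on the solutions of \<open>P\<close>.\<close>

definition coded ::
  "('a \<Rightarrow> baire) \<Rightarrow> ('b \<Rightarrow> baire) \<Rightarrow> ('a, 'b) problem \<Rightarrow> (baire, baire) problem" where
  "coded c d P =
     \<lparr>instances = c ` instances P,
      solutions = (\<lambda>p. {d y | x y. x \<in> instances P \<and> c x = p \<and> y \<in> solutions P x})\<rparr>"

definition nat_code :: "nat \<Rightarrow> baire" where
  "nat_code a = (\<lambda>_. a)"

definition fun_code :: "nat \<Rightarrow> (nat \<Rightarrow> nat) \<Rightarrow> nat" where
  "fun_code m f = list_encode (map f [0..<m])"

definition coded_PHP :: "nat \<Rightarrow> nat \<Rightarrow> (baire, baire) problem" where
  "coded_PHP m n =
     coded (\<lambda>f. nat_code (fun_code m f)) (\<lambda>y. nat_code (set_encode y)) (PHP m n)"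

definition coded_PHP_jump :: "nat \<Rightarrow> nat \<Rightarrow> (baire, baire) problem" where
  "coded_PHP_jump m n =
     coded (\<lambda>f s. fun_code m (f s)) (\<lambda>y. nat_code (set_encode y)) (PHP_jump m n)"

definition coded_id :: "nat \<Rightarrow> (baire, baire) problem" where
  "coded_id k = coded nat_code nat_code (id_problem k)"

definition coded_lim :: "nat \<Rightarrow> (baire, baire) problem" where
  "coded_lim k = coded (\<lambda>p. p) nat_code (lim_problem k)"


section \<open>Turing functionals\<close>

text \<open>Terms for the partial recursive functions relative to a point \<open>p\<close> of Baire space; \<open>Query\<close>
  asks for a value of \<open>p\<close>.\<close>

datatype rterm =
    Zero
  | Succ
  | Proj nat
  | Query
  | Comp rterm "rterm list"
  | PRec rterm rterm
  | Mu rterm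

text \<open>A term applied to an argument list of unsuitable length is undefined. Composition is strict:
  all inner terms have to be defined. In \<open>PRec f g\<close> the first argument is the recursion variable,
  and \<open>g\<close> gets the predecessor, the previous value and the parameters, in this order. The value
  \<open>y\<close> of a minimization requires the searched function to be defined at every \<open>z \<le> y\<close>.\<close>

fun reval :: "baire \<Rightarrow> rterm \<Rightarrow> nat list \<rightharpoonup> nat" where
  "reval p Zero xs = Some 0"
| "reval p Succ xs = (case xs of [x] \<Rightarrow> Some (Suc x) | _ \<Rightarrow> None)"
| "reval p (Proj i) xs = (if i < length xs then Some (xs ! i) else None)"
| "reval p Query xs = (case xs of [x] \<Rightarrow> Some (p x) | _ \<Rightarrow> None)"
| "reval p (Comp f gs) xs =
     (case those (map (\<lambda>g. reval p g xs) gs) of None \<Rightarrow> None | Some ys \<Rightarrow> reval p f ys)"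
| "reval p (PRec f g) xs =
     (case xs of
        [] \<Rightarrow> None
      | x # ys \<Rightarrow>
          rec_nat (reval p f ys)
            (\<lambda>i r. case r of None \<Rightarrow> None | Some v \<Rightarrow> reval p g (i # v # ys)) x)"
| "reval p (Mu f) xs =
     (if \<exists>y. reval p f (y # xs) = Some 0 \<and> (\<forall>z<y. reval p f (z # xs) \<noteq> None)
      then Some (LEAST y. reval p f (y # xs) = Some 0)
      else None)"

definition functional_of :: "rterm \<Rightarrow> baire \<rightharpoonup> baire" where
  "functional_of e p =
     (if \<forall>x. reval p e [x] \<noteq> None then Some (\<lambda>x. the (reval p e [x])) else None)"

definition turing_functional :: "(baire \<rightharpoonup> baire) \<Rightarrow> bool" where
  "turing_functional F \<longleftrightarrow> (\<exists>e. F = functional_of e)"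

text \<open>The topology on \<^typ>\<open>nat \<Rightarrow> nat\<close> is the product of the discrete topologies, i.e. the Baire
  topology.\<close>

definition continuous_functional :: "(baire \<rightharpoonup> baire) \<Rightarrow> bool" where
  "continuous_functional F \<longleftrightarrow> continuous_on (dom F) (\<lambda>p. the (F p))"


section \<open>Reducibilities\<close>

definition finite_reducible :: "('a, 'b) problem \<Rightarrow> ('c, 'd) problem \<Rightarrow> bool"
    (infix \<open>\<le>\<^sub>f\<^sub>i\<^sub>n\<close> 50) where
  "P \<le>\<^sub>f\<^sub>i\<^sub>n Q \<longleftrightarrow>
     (\<exists>(\<Phi> :: 'a \<Rightarrow> 'c) (\<Psi> :: 'd \<rightharpoonup> 'b).
        \<forall>x\<in>instances P. \<Phi> x \<in> instances Q \<and>
          (\<forall>y\<in>solutions Q (\<Phi> x). \<exists>z. \<Psi> y = Some z \<and> z \<in> solutions P x))"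

definition sW_reducible :: "(baire, baire) problem \<Rightarrow> (baire, baire) problem \<Rightarrow> bool"
    (infix \<open>\<le>\<^sub>s\<^sub>W\<close> 50) where
  "P \<le>\<^sub>s\<^sub>W Q \<longleftrightarrow>
     (\<exists>\<Phi> \<Psi>. turing_functional \<Phi> \<and> turing_functional \<Psi> \<and>
        (\<forall>p\<in>instances P. \<exists>p'. \<Phi> p = Some p' \<and> p' \<in> instances Q \<and>
          (\<forall>q\<in>solutions Q p'. \<exists>r. \<Psi> q = Some r \<and> r \<in> solutions P p)))"

definition continuous_sW_reducible ::
  "(baire, baire) problem \<Rightarrow> (baire, baire) problem \<Rightarrow> bool"
    (infix \<open>\<le>\<^sup>*\<^sub>s\<^sub>W\<close> 50) where
  "P \<le>\<^sup>*\<^sub>s\<^sub>W Q \<longleftrightarrow>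
     (\<exists>\<Phi> \<Psi>. continuous_functional \<Phi> \<and> continuous_functional \<Psi> \<and>
        (\<forall>p\<in>instances P. \<exists>p'. \<Phi> p = Some p' \<and> p' \<in> instances Q \<and>
          (\<forall>q\<in>solutions Q p'. \<exists>r. \<Psi> q = Some r \<and> r \<in> solutions P p)))"

definition baire_pair :: "baire \<Rightarrow> baire \<Rightarrow> baire" where
  "baire_pair p q = (\<lambda>x. if even x then p (x div 2) else q (x div 2))"

definition W_reducible :: "(baire, baire) problem \<Rightarrow> (baire, baire) problem \<Rightarrow> bool"
    (infix \<open>\<le>\<^sub>W\<close> 50) where
  "P \<le>\<^sub>W Q \<longleftrightarrow>
     (\<exists>\<Phi> \<Psi>. turing_functional \<Phi> \<and> turing_functional \<Psi> \<and>
        (\<forall>p\<in>instances P. \<exists>p'. \<Phi> p = Some p' \<and> p' \<in> instances Q \<and>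
          (\<forall>q\<in>solutions Q p'. \<exists>r. \<Psi> (baire_pair p q) = Some r \<and> r \<in> solutions P p)))"


section \<open>Sanity checks\<close>

lemma inj_nat_code: "inj nat_code"
  by (rule injI) (simp add: nat_code_def fun_eq_iff)

lemma inj_on_fun_code: "inj_on (fun_code m) ({..<m} \<rightarrow>\<^sub>E {..<n})"
proof (rule inj_onI)
  fix f g assume fg: "f \<in> {..<m} \<rightarrow>\<^sub>E {..<n}" "g \<in> {..<m} \<rightarrow>\<^sub>E {..<n}" "fun_code m f = fun_code m g"
  then have "f i = g i" if "i < m" for i
    using that by (auto simp: fun_code_def list_encode_eq)
  with fg(1,2) show "f = g" by (intro PiE_ext) auto
qed

lemma inj_on_pair_code:
  "inj_on (\<lambda>y. nat_code (set_encode y)) {y. \<exists>i j. y = {i, j}}"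
proof (rule inj_onI)
  fix y z :: "nat set"
  assume "y \<in> {y. \<exists>i j. y = {i, j}}" "z \<in> {y. \<exists>i j. y = {i, j}}"
    and eq: "nat_code (set_encode y) = nat_code (set_encode z)"
  then have "finite y" "finite z" by auto
  with injD[OF inj_nat_code eq] show "y = z" by (simp add: set_encode_eq)
qed

lemma inj_on_fun_seq_code:
  "inj_on (\<lambda>f s. fun_code m (f s)) (instances (PHP_jump m n))"
proof (rule inj_onI)
  fix f g assume "f \<in> instances (PHP_jump m n)" "g \<in> instances (PHP_jump m n)"
    and eq: "(\<lambda>s. fun_code m (f s)) = (\<lambda>s. fun_code m (g s))"
  then have "f s \<in> {..<m} \<rightarrow>\<^sub>E {..<n}" "g s \<in> {..<m} \<rightarrow>\<^sub>E {..<n}" for s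
    by (auto simp: PHP_jump_def)
  moreover have "fun_code m (f s) = fun_code m (g s)" for s
    using fun_cong[OF eq] .
  ultimately show "f = g"
    by (intro ext[where f = f]) (blast intro: inj_onD[OF inj_on_fun_code])
qed

lemma pigeonhole_lessThan:
  fixes f :: "nat \<Rightarrow> nat"
  assumes "n < m" "\<And>i. i < m \<Longrightarrow> f i < n"
  shows "\<exists>i j. i < m \<and> j < m \<and> i \<noteq> j \<and> f i = f j"
proof -
  have "f ` {..<m} \<subseteq> {..<n}" using assms(2) by auto
  then have "card (f ` {..<m}) \<le> n" using card_mono[of "{..<n}"] by simp
  with assms(1) have "\<not> inj_on f {..<m}" using card_image by fastforce
  then show ?thesis by (auto simp: inj_on_def)
qed

lemma lim_nat_less:
  fixes p :: "nat \<Rightarrow> nat"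
  assumes "convergent p" "\<And>s. p s < k"
  shows "lim p < k"
proof -
  have "p \<longlonglongrightarrow> lim p" using assms(1) by (simp add: convergent_LIMSEQ_iff)
  then have "eventually (\<lambda>s. p s = lim p) sequentially" by (simp add: tendsto_discrete)
  then obtain s where "p s = lim p" by (auto simp: eventually_sequentially)
  then show ?thesis using assms(2)[of s] by simp
qed

lemma is_finite_problem_PHP:
  assumes "n < m" "2 \<le> n"
  shows "is_finite_problem (PHP m n)"
proof -
  have "(\<lambda>i\<in>{..<m}. 0) \<in> instances (PHP m n)" using assms by (auto simp: PHP_def)
  then have "instances (PHP m n) \<noteq> {}" by blast
  moreover have "solutions (PHP m n) f \<noteq> {}" if "f \<in> instances (PHP m n)" for f
  proof -
    have "f i < n" if "i < m" for i
      using that \<open>f \<in> _\<close> by (auto simp: PHP_def)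
    then obtain i j where "i < m" "j < m" "i \<noteq> j" "f i = f j"
      using pigeonhole_lessThan[of n m f] assms(1) by blast
    then show ?thesis unfolding PHP_def by (simp, blast)
  qed
  moreover have "finite (solutions (PHP m n) f)" for f
    by (rule finite_subset[of _ "Pow {..<m}"]) (auto simp: PHP_def)
  moreover have "finite (instances (PHP m n))" by (simp add: PHP_def finite_PiE)
  ultimately show ?thesis by (simp add: is_finite_problem_def is_problem_def)
qed

lemma is_problem_PHP_jump:
  assumes "n < m" "2 \<le> n"
  shows "is_problem (PHP_jump m n)"
proof -
  have "(\<lambda>_. \<lambda>i\<in>{..<m}. 0) \<in> instances (PHP_jump m n)"
    using assms by (auto simp: PHP_jump_def convergent_const)
  moreover have "solutions (PHP_jump m n) f \<noteq> {}" if "f \<in> instances (PHP_jump m n)" for f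
  proof -
    have "lim (\<lambda>s. f s i) < n" if "i < m" for i
      using that \<open>f \<in> _\<close> by (intro lim_nat_less) (auto simp: PHP_jump_def)
    then obtain i j where "i < m" "j < m" "i \<noteq> j" "lim (\<lambda>s. f s i) = lim (\<lambda>s. f s j)"
      using pigeonhole_lessThan[of n m "\<lambda>i. lim (\<lambda>s. f s i)"] assms(1) by blast
    then show ?thesis unfolding PHP_jump_def by (simp, blast)
  qed
  ultimately show ?thesis by (auto simp: is_problem_def)
qed

lemma is_finite_problem_id: "1 \<le> k \<Longrightarrow> is_finite_problem (id_problem k)"
  by (simp add: is_finite_problem_def is_problem_def id_problem_def)

lemma is_problem_lim: "2 \<le> k \<Longrightarrow> is_problem (lim_problem k)"
proof -
  assume "2 \<le> k"
  then have "(\<lambda>_. 0) \<in> instances (lim_problem k)"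
    by (simp add: lim_problem_def convergent_const)
  then have "instances (lim_problem k) \<noteq> {}" by blast
  then show ?thesis by (simp add: is_problem_def lim_problem_def)
qed

end

theory Submission
  imports Defs
begin

text \<open>Every problem in the statement is a finite problem \<open>P\<close> or its jump, \<open>lim_problem k\<close> being the
  jump of \<open>id_problem k\<close>. A finite reduction is given by finite tables, which Turing functionals can
  apply pointwise to a sequence; this settles all implications from the finite to the infinite.
  Conversely, a strong reduction between jumps restricts to constant sequences. For a Weihrauch
  reduction the backward functional \<open>\<Psi>\<close> also reads the instance \<open>p\<close>. Since the target has only
  finitely many solutions \<open>y\<close>, one can successively extend a finite prefix of \<open>p\<close> such that, for each
  \<open>y\<close>, the value \<open>\<Psi>(p, y)(0)\<close> is either the same for all \<open>p\<close> with this prefix or never defined.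
  Appending the constant sequence \<open>x\<close> to that prefix then turns \<open>\<Psi>\<close> into a map of \<open>y\<close> alone.\<close>

section \<open>Continuity of Turing functionals\<close>

text \<open>The neighbourhoods of \<open>p\<close>, presented by finite prefixes. Using a filter
  lets the finitely many oracle queries of a computation be combined without tracking an explicit
  bound on the prefix.\<close>

definition cylinders :: "baire \<Rightarrow> baire filter" where
  "cylinders p = (INF N. principal {q. \<forall>i<N. q i = p i})"

lemma eventually_cylinders:
  "eventually P (cylinders p) \<longleftrightarrow> (\<exists>N. \<forall>q. (\<forall>i<N. q i = p i) \<longrightarrow> P q)"
proof -
  have "eventually P (cylinders p) \<longleftrightarrow>
      (\<exists>N\<in>UNIV. eventually P (principal {q. \<forall>i<N. q i = p i}))"
    unfolding cylinders_def
  proof (rule eventually_INF_base)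
    fix a b :: nat
    show "\<exists>x\<in>UNIV. principal {q. \<forall>i<x. q i = p i}
        \<le> inf (principal {q. \<forall>i<a. q i = p i}) (principal {q. \<forall>i<b. q i = p i})"
      by (rule bexI[of _ "max a b"]) auto
  qed simp
  then show ?thesis by (simp add: eventually_principal)
qed

lemma eventually_cylinders_nth: "\<forall>\<^sub>F q in cylinders p. q i = p i"
  unfolding eventually_cylinders by (rule exI[of _ "Suc i"]) simp

text \<open>Coordinate projections are continuous into a discrete space, so agreement on a finite
  prefix is a finite conjunction of open conditions.\<close>

lemma nhds_le_cylinders: "nhds p \<le> cylinders p"
proof (rule filter_leI)
  fix P assume "eventually P (cylinders p)"
  then obtain N where N: "\<And>q. (\<forall>i<N. q i = p i) \<Longrightarrow> P q"
    by (auto simp: eventually_cylinders)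
  have "open ((\<lambda>q::baire. q i) -` {p i})" for i
    by (rule open_vimage) (auto intro: continuous_on_product_coordinates open_discrete)
  from eventually_nhds_in_open[OF this] have "\<forall>\<^sub>F q in nhds p. q i = p i" for i
    by simp
  then have "\<forall>\<^sub>F q in nhds p. \<forall>i\<in>{..<N}. q i = p i"
    by (intro eventually_ball_finite) auto
  then show "eventually P (nhds p)"
    by eventually_elim (auto intro: N)
qed

text \<open>The use principle: a halting computation queries its oracle only finitely often, so
  every oracle sharing a long enough prefix yields the same value.\<close>

lemma reval_locally_constant:
  "reval p e xs = Some v \<Longrightarrow> \<forall>\<^sub>F q in cylinders p. reval q e xs = Some v"
proof (induction e arbitrary: xs v)
  case Query
  then obtain x where x: "xs = [x]" "v = p x" by (auto split: list.splits)
  show ?case using eventually_cylinders_nth[of x p] by eventually_elim (simp add: x)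
next
  case (Comp f gs)
  from Comp.prems obtain ys
    where ys: "those (map (\<lambda>g. reval p g xs) gs) = Some ys" "reval p f ys = Some v"
    by (auto split: option.splits)
  have def: "\<exists>w. reval p g xs = Some w" if "g \<in> set gs" for g
    using ys(1) that
  proof (induction gs arbitrary: ys)
    case (Cons a gs)
    then show ?case by (auto split: option.splits)
  qed simp
  \<comment> \<open>Composition is strict, so every inner term is defined at \<open>p\<close> and
    the induction hypothesis applies to each of them.\<close>
  have "\<forall>\<^sub>F q in cylinders p. reval q g xs = reval p g xs" if "g \<in> set gs" for g
    using def[OF that] Comp.IH(2)[OF that] by auto
  then have "\<forall>\<^sub>F q in cylinders p. \<forall>g\<in>set gs. reval q g xs = reval p g xs"
    by (intro eventually_ball_finite) auto
  with Comp.IH(1)[OF ys(2)] show ?case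
  proof eventually_elim
    case (elim q)
    then have "map (\<lambda>g. reval q g xs) gs = map (\<lambda>g. reval p g xs) gs" by simp
    with elim(1) ys(1) show ?case by (simp only: reval.simps option.case)
  qed
next
  case (PRec f g)
  then obtain x ys where xs: "xs = x # ys" by (auto split: list.splits)
  show ?case using PRec.prems unfolding xs
  proof (induction x arbitrary: v)
    case 0
    then show ?case using PRec.IH(1) by simp
  next
    case (Suc x)
    then obtain w where w: "reval p (PRec f g) (x # ys) = Some w" "reval p g (x # w # ys) = Some v"
      by (auto split: option.splits)
    from Suc.IH[OF w(1)] PRec.IH(2)[OF w(2)] show ?case
      by eventually_elim simp
  qed
next
  case (Mu f)
  from Mu.prems obtain y where y: "reval p f (y # xs) = Some 0" "\<forall>z<y. reval p f (z # xs) \<noteq> None"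
    and v: "v = (LEAST y. reval p f (y # xs) = Some 0)"
    by (auto split: if_splits)
  have v0: "reval p f (v # xs) = Some 0" unfolding v by (rule LeastI) (rule y)
  have vy: "v \<le> y" unfolding v by (rule Least_le) (rule y)
  have vmin: "reval p f (z # xs) \<noteq> Some 0" if "z < v" for z
    using not_less_Least that unfolding v by blast
  \<comment> \<open>The search inspects only the arguments up to its result \<open>v\<close>. All of
    them are defined because \<open>v \<le> y\<close>, so finitely many uses of the induction
    hypothesis suffice.\<close>
  have "\<forall>\<^sub>F q in cylinders p. reval q f (z # xs) = reval p f (z # xs)" if "z \<in> {..v}" for z
  proof -
    have "\<exists>w. reval p f (z # xs) = Some w"
      using y v0 vy that by (cases "z = y") auto
    then show ?thesis using Mu.IH by auto
  qed
  then have "\<forall>\<^sub>F q in cylinders p. \<forall>z\<in>{..v}. reval q f (z # xs) = reval p f (z # xs)"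
    by (intro eventually_ball_finite) auto
  then show ?case
  proof eventually_elim
    case (elim q)
    then have "reval q f (v # xs) = Some 0" "\<forall>z<v. reval q f (z # xs) \<noteq> None"
      using v0 y vy by auto
    moreover have "(LEAST y. reval q f (y # xs) = Some 0) = v"
    proof (rule Least_equality)
      fix z assume "reval q f (z # xs) = Some 0"
      then show "v \<le> z" using elim vmin[of z] by (force simp: not_less[symmetric])
    qed (use elim v0 in simp)
    ultimately show ?case by auto
  qed
qed (auto split: list.splits if_splits)

text \<open>A single output value depends on a finite prefix, but \<open>F\<close> may still be
  undefined at a nearby \<open>q\<close> because of other output positions; hence the conditional
  form.\<close>

lemma turing_functional_locally_constant:
  assumes "turing_functional F" "F p = Some r"
  shows "\<forall>\<^sub>F q in cylinders p. \<forall>r'. F q = Some r' \<longrightarrow> r' x = r x"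
proof -
  from assms(1) obtain e where e: "F = functional_of e" by (auto simp: turing_functional_def)
  have "reval p e [x] = Some (r x)"
    using assms(2) by (auto simp: e functional_of_def split: if_splits)
  from reval_locally_constant[OF this] show ?thesis
    by eventually_elim (auto simp: e functional_of_def split: if_splits)
qed

lemma turing_functional_continuous:
  assumes "turing_functional F"
  shows "continuous_functional F"
  unfolding continuous_functional_def
proof (rule continuous_on_coordinatewise_then_product)
  fix x
  show "continuous_on (dom F) (\<lambda>p. the (F p) x)"
    unfolding continuous_on_def
  proof
    fix p assume "p \<in> dom F"
    then obtain r where r: "F p = Some r" by auto
    have "\<forall>\<^sub>F q in nhds p. \<forall>r'. F q = Some r' \<longrightarrow> r' x = r x"
      using turing_functional_locally_constant[where F = F, OF assms r] nhds_le_cylinders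
      by (simp add: le_filter_def)
    then have "\<forall>\<^sub>F q in at p within dom F. the (F q) x = the (F p) x"
      unfolding eventually_at_filter by eventually_elim (auto simp: r)
    then show "((\<lambda>p. the (F p) x) \<longlongrightarrow> the (F p) x) (at p within dom F)"
      by (simp add: tendsto_discrete)
  qed
qed

lemma sW_reducible_imp_continuous: "P \<le>\<^sub>s\<^sub>W Q \<Longrightarrow> P \<le>\<^sup>*\<^sub>s\<^sub>W Q"
  unfolding sW_reducible_def continuous_sW_reducible_def
  using turing_functional_continuous by meson


section \<open>Strong reductions are Weihrauch reductions\<close>

fun const_term :: "nat \<Rightarrow> rterm" where
  "const_term 0 = Zero"
| "const_term (Suc a) = Comp Succ [const_term a]"

lemma reval_const_term [simp]: "reval p (const_term a) xs = Some a"
  by (induction a) auto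

text \<open>The detour through \<^const>\<open>Succ\<close> and its predecessor makes the term undefined, like \<^const>\<open>Query\<close>,
  on argument lists of length other than one.\<close>

definition odd_term :: rterm where
  "odd_term = Comp (PRec (const_term 1) (Comp Succ [Comp Succ [Proj 1]]))
                [Comp (PRec Zero (Proj 0)) [Succ]]"

lemma reval_odd_term:
  "reval p odd_term xs = (case xs of [x] \<Rightarrow> Some (Suc (2 * x)) | _ \<Rightarrow> None)"
proof -
  have "reval p (PRec (const_term 1) (Comp Succ [Comp Succ [Proj 1]])) [x] = Some (Suc (2 * x))" for x
    by (induction x) auto
  moreover have "reval p (PRec Zero (Proj 0)) [Suc x] = Some x" for x
    by (induction x) auto
  ultimately show ?thesis
    unfolding odd_term_def by (simp del: reval.simps(6) split: list.splits)
qed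

text \<open>Redirects every query to the odd positions, where \<open>baire_pair\<close> stores its
  second component. A backward functional that reads only the solution thereby becomes one that
  reads the pair.\<close>

fun query_odd :: "rterm \<Rightarrow> rterm" where
  "query_odd Query = Comp Query [odd_term]"
| "query_odd (Comp f gs) = Comp (query_odd f) (map query_odd gs)"
| "query_odd (PRec f g) = PRec (query_odd f) (query_odd g)"
| "query_odd (Mu f) = Mu (query_odd f)"
| "query_odd e = e"

lemma reval_query_odd: "reval (baire_pair p q) (query_odd e) xs = reval q e xs"
proof (induction e arbitrary: xs)
  case Query
  show ?case by (simp add: reval_odd_term baire_pair_def split: list.splits)
next
  case (Comp f gs)
  have "map (\<lambda>g. reval (baire_pair p q) g xs) (map query_odd gs) = map (\<lambda>g. reval q g xs) gs"
    by (simp add: Comp.IH(2))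
  then show ?case by (simp only: query_odd.simps reval.simps Comp.IH(1) cong: option.case_cong)
qed (simp_all split: list.splits)

lemma sW_reducible_imp_W:
  assumes "P \<le>\<^sub>s\<^sub>W Q"
  shows "P \<le>\<^sub>W Q"
proof -
  from assms obtain \<Phi> e where "turing_functional \<Phi>"
    and red: "\<forall>p\<in>instances P. \<exists>p'. \<Phi> p = Some p' \<and> p' \<in> instances Q \<and>
          (\<forall>q\<in>solutions Q p'. \<exists>r. functional_of e q = Some r \<and> r \<in> solutions P p)"
    unfolding sW_reducible_def turing_functional_def by blast
  moreover have "functional_of (query_odd e) (baire_pair p q) = functional_of e q" for p q
    by (simp add: functional_of_def reval_query_odd)
  moreover have "turing_functional (functional_of (query_odd e))"
    by (auto simp: turing_functional_def)
  ultimately show ?thesis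
    unfolding W_reducible_def by (intro exI[of _ \<Phi>] exI[of _ "functional_of (query_odd e)"]) simp
qed


section \<open>Computing finite tables\<close>

text \<open>Induction on the length of the table, with the table shifted by one: entry 0 is the base
  value of a primitive recursion whose step ignores the previous value and looks up the predecessor
  in the shifted table.\<close>

lemma table_term_exists: "\<exists>e. \<forall>p x. x < N \<longrightarrow> reval p e [x] = Some (h x)"
proof (induction N arbitrary: h)
  case (Suc N)
  from Suc.IH[of "\<lambda>x. h (Suc x)"] obtain e
    where e: "\<And>p x. x < N \<Longrightarrow> reval p e [x] = Some (h (Suc x))"
    by blast
  have "reval p (PRec (const_term (h 0)) (Comp e [Proj 0])) [x] = Some (h x)" if "x < Suc N" for p x
    using that by (induction x) (auto simp: e)
  then show ?case by blast
qed simp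

text \<open>Output position \<open>s\<close> needs one query at \<open>s\<close> followed by a table
  lookup; finiteness of \<open>A\<close> bounds the codes, and injectivity of \<open>c\<close> lets
  the table decode them.\<close>

lemma pointwise_turing_functional:
  fixes c :: "'a \<Rightarrow> nat"
  assumes "finite A" "inj_on c A"
  obtains F where "turing_functional F"
    "\<And>f. (\<And>s. f s \<in> A) \<Longrightarrow> F (\<lambda>s. c (f s)) = Some (\<lambda>s. h (f s))"
proof -
  from \<open>finite A\<close> obtain N where N: "\<And>a. a \<in> A \<Longrightarrow> c a < N"
    using finite_nat_set_iff_bounded[of "c ` A"] by auto
  obtain e where e: "\<And>p x. x < N \<Longrightarrow> reval p e [x] = Some (h (inv_into A c x))"
    using table_term_exists[of N "\<lambda>x. h (inv_into A c x)"] by blast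
  show ?thesis
  proof
    show "turing_functional (functional_of (Comp e [Query]))"
      by (auto simp: turing_functional_def)
  next
    fix f :: "nat \<Rightarrow> 'a" assume "\<And>s. f s \<in> A"
    then show "functional_of (Comp e [Query]) (\<lambda>s. c (f s)) = Some (\<lambda>s. h (f s))"
      by (simp add: functional_of_def e N inv_into_f_f[OF assms(2)])
  qed
qed


section \<open>Finite problems and their jumps\<close>

text \<open>The union over all instances matters because a backward map sees a solution without its
  instance, so codes must be decodable across instances.\<close>

definition all_solutions :: "('a, 'b) problem \<Rightarrow> 'b set" where
  "all_solutions P = (\<Union>x\<in>instances P. solutions P x)"

text \<open>Convergence in a discrete space is eventual constancy. For functions between finite sets
  this agrees with pointwise convergence.\<close>

definition jump :: "('a, 'b) problem \<Rightarrow> (nat \<Rightarrow> 'a, 'b) problem" where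
  "jump P =
     \<lparr>instances = {f. (\<forall>s. f s \<in> instances P) \<and> (\<exists>x. \<forall>\<^sub>F s in sequentially. f s = x)},
      solutions = (\<lambda>f. {y. \<exists>x. (\<forall>\<^sub>F s in sequentially. f s = x) \<and> y \<in> solutions P x})\<rparr>"

lemma eventually_const_unique:
  assumes "\<forall>\<^sub>F s in sequentially. f s = x" "\<forall>\<^sub>F s in sequentially. f s = y"
  shows "x = y"
proof -
  from assms have "\<forall>\<^sub>F s :: nat in sequentially. x = y" by eventually_elim simp
  then show ?thesis by simp
qed

lemma solutions_jump:
  assumes "\<forall>\<^sub>F s in sequentially. f s = x"
  shows "solutions (jump P) f = solutions P x"
proof -
  have "(\<forall>\<^sub>F s in sequentially. f s = z) \<longleftrightarrow> z = x" for z
    using assms eventually_const_unique[of f x z] by blast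
  then show ?thesis by (simp add: jump_def)
qed

text \<open>The limit occurs as a term of the sequence and is therefore itself an instance of
  \<open>P\<close>.\<close>

lemma jump_instance_limit:
  assumes "f \<in> instances (jump P)"
  obtains x where "x \<in> instances P" "\<forall>\<^sub>F s in sequentially. f s = x"
    "solutions (jump P) f = solutions P x"
proof -
  from assms obtain x where x: "\<forall>\<^sub>F s in sequentially. f s = x" and f: "\<And>s. f s \<in> instances P"
    by (auto simp: jump_def)
  then obtain s where "f s = x" by (auto simp: eventually_sequentially)
  with f[of s] have "x \<in> instances P" by simp
  then show ?thesis using x solutions_jump[OF x] by (rule that)
qed

lemma const_in_jump: "x \<in> instances P \<Longrightarrow> (\<lambda>_. x) \<in> instances (jump P)"
  by (auto simp: jump_def)

lemma all_solutions_jump: "all_solutions (jump P) \<subseteq> all_solutions P"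
proof
  fix y assume "y \<in> all_solutions (jump P)"
  then obtain f where f: "f \<in> instances (jump P)" "y \<in> solutions (jump P) f"
    by (auto simp: all_solutions_def)
  then show "y \<in> all_solutions P"
    by (elim jump_instance_limit) (auto simp: all_solutions_def)
qed

text \<open>Embed \<open>P\<close> by constant sequences and take the limit of the sequence produced
  by \<open>\<Phi>\<close>. The backward map stays the same, since solutions of a jump depend only
  on the limit. The relation \<open>\<le>\<^sub>f\<^sub>i\<^sub>n\<close> itself makes sense for
  infinite problems such as jumps.\<close>

lemma finite_reducible_jumpD:
  assumes "jump P \<le>\<^sub>f\<^sub>i\<^sub>n jump Q"
  shows "P \<le>\<^sub>f\<^sub>i\<^sub>n Q"
proof -
  from assms obtain \<Phi> \<Psi> where red: "\<forall>f\<in>instances (jump P). \<Phi> f \<in> instances (jump Q) \<and>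
      (\<forall>y\<in>solutions (jump Q) (\<Phi> f). \<exists>z. \<Psi> y = Some z \<and> z \<in> solutions (jump P) f)"
    unfolding finite_reducible_def by blast
  have "\<exists>x'. x' \<in> instances Q \<and> (\<forall>y\<in>solutions Q x'. \<exists>z. \<Psi> y = Some z \<and> z \<in> solutions P x)"
    if x: "x \<in> instances P" for x
  proof -
    have "solutions (jump P) (\<lambda>_. x) = solutions P x" by (rule solutions_jump) simp
    moreover obtain x' where "x' \<in> instances Q"
      "solutions (jump Q) (\<Phi> (\<lambda>_. x)) = solutions Q x'"
      using jump_instance_limit[of "\<Phi> (\<lambda>_. x)" Q] red const_in_jump[OF x] by metis
    ultimately show ?thesis using red const_in_jump[OF x] by force
  qed
  then show ?thesis unfolding finite_reducible_def by meson
qed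

section \<open>Coding and decoding of problems\<close>

lemma solutions_coded:
  assumes "inj_on c (instances P)" "x \<in> instances P"
  shows "solutions (coded c d P) (c x) = d ` solutions P x"
  using assms by (auto simp: coded_def dest: inj_onD)

lemma instances_coded: "instances (coded c d P) = c ` instances P"
  by (simp add: coded_def)

lemma coded_cong:
  assumes "instances P = instances Q" "\<And>x. x \<in> instances Q \<Longrightarrow> solutions P x = solutions Q x"
  shows "coded c d P = coded c d Q"
proof -
  have "{d y |x y. x \<in> instances P \<and> c x = p \<and> y \<in> solutions P x} =
      {d y |x y. x \<in> instances Q \<and> c x = p \<and> y \<in> solutions Q x}" for p
    using assms by blast
  then show ?thesis by (simp add: coded_def assms(1))
qed

lemma inj_on_seq_code:
  "inj_on c (instances P) \<Longrightarrow> inj_on (\<lambda>f s. c (f s)) (instances (jump P))"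
  by (rule inj_onI) (auto simp: jump_def fun_eq_iff dest: inj_onD)

lemma inj_on_nat_code_comp: "inj_on d A \<Longrightarrow> inj_on (\<lambda>y. nat_code (d y)) A"
  by (auto simp: inj_on_def dest: injD[OF inj_nat_code])

text \<open>Conjugating the two functionals with the codings gives maps on the uncoded problems.
  Injectivity of \<open>d\<close> on all solutions lets \<open>\<psi>\<close> decode without knowing
  the instance.\<close>

lemma finite_reducible_of_coded:
  assumes "inj_on c (instances P)" "inj_on d (all_solutions P)" "inj_on c' (instances Q)"
    and "coded c d P \<le>\<^sup>*\<^sub>s\<^sub>W coded c' d' Q"
  shows "P \<le>\<^sub>f\<^sub>i\<^sub>n Q"
proof -
  from assms(4) obtain \<Phi> \<Psi> where red: "\<forall>p\<in>instances (coded c d P).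
      \<exists>p'. \<Phi> p = Some p' \<and> p' \<in> instances (coded c' d' Q) \<and>
        (\<forall>q\<in>solutions (coded c' d' Q) p'. \<exists>r. \<Psi> q = Some r \<and> r \<in> solutions (coded c d P) p)"
    unfolding continuous_sW_reducible_def by blast
  define \<psi> where "\<psi> y = map_option (inv_into (all_solutions P) d) (\<Psi> (d' y))" for y
  have "\<exists>x'. x' \<in> instances Q \<and> (\<forall>y\<in>solutions Q x'. \<exists>z. \<psi> y = Some z \<and> z \<in> solutions P x)"
    if x: "x \<in> instances P" for x
  proof -
    have "c x \<in> instances (coded c d P)" using x by (simp add: instances_coded)
    with red obtain p' where p': "p' \<in> instances (coded c' d' Q)"
      "\<forall>q\<in>solutions (coded c' d' Q) p'. \<exists>r. \<Psi> q = Some r \<and> r \<in> solutions (coded c d P) (c x)"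
      by blast
    from p'(1) obtain x' where x': "x' \<in> instances Q" "p' = c' x'" by (auto simp: instances_coded)
    have "\<exists>z. \<psi> y = Some z \<and> z \<in> solutions P x" if "y \<in> solutions Q x'" for y
    proof -
      from p'(2) that obtain r where "\<Psi> (d' y) = Some r" "r \<in> d ` solutions P x"
        by (auto simp: x'(2) solutions_coded[OF assms(3) x'(1)] solutions_coded[OF assms(1) x])
      then obtain z where z: "\<Psi> (d' y) = Some (d z)" "z \<in> solutions P x" by auto
      then have "z \<in> all_solutions P" using x by (auto simp: all_solutions_def)
      with z show ?thesis by (simp add: \<psi>_def inv_into_f_f[OF assms(2)])
    qed
    with x'(1) show ?thesis by blast
  qed
  then show ?thesis unfolding finite_reducible_def by meson
qed

text \<open>The numberings are parameters because \<open>id_problem\<close> is used with two of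
  them: the identity for its own code, and a shift by one for the limit problem.\<close>

locale numbered_problem =
  fixes P :: "('a, 'b) problem" and c :: "'a \<Rightarrow> nat" and d :: "'b \<Rightarrow> nat"
  assumes finite_instances: "finite (instances P)"
    and finite_all_solutions: "finite (all_solutions P)"
    and inj_instances: "inj_on c (instances P)"
    and inj_solutions: "inj_on d (all_solutions P)"
begin

definition code :: "(baire, baire) problem" where
  "code = coded (\<lambda>x. nat_code (c x)) (\<lambda>y. nat_code (d y)) P"

definition jump_code :: "(baire, baire) problem" where
  "jump_code = coded (\<lambda>f s. c (f s)) (\<lambda>y. nat_code (d y)) (jump P)"

lemma solutions_code:
  "x \<in> instances P \<Longrightarrow> solutions code (nat_code (c x)) = (\<lambda>y. nat_code (d y)) ` solutions P x"
  unfolding code_def by (rule solutions_coded[OF inj_on_nat_code_comp[OF inj_instances]])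

lemma solutions_jump_code:
  "f \<in> instances (jump P) \<Longrightarrow>
    solutions jump_code (\<lambda>s. c (f s)) = (\<lambda>y. nat_code (d y)) ` solutions (jump P) f"
  unfolding jump_code_def by (rule solutions_coded[OF inj_on_seq_code[OF inj_instances]])

end

section \<open>Reductions between two numbered problems\<close>

locale numbered_problems =
  P: numbered_problem P c d + Q: numbered_problem Q c' d'
  for P :: "('a, 'b) problem" and c d and Q :: "('e, 'f) problem" and c' d'
begin

lemma finite_reducible_of_code: "P.code \<le>\<^sup>*\<^sub>s\<^sub>W Q.code \<Longrightarrow> P \<le>\<^sub>f\<^sub>i\<^sub>n Q"
  unfolding P.code_def Q.code_def
  by (erule finite_reducible_of_coded[rotated 3];
      intro inj_on_nat_code_comp P.inj_instances P.inj_solutions Q.inj_instances)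

lemma finite_reducible_of_jump_code:
  assumes "P.jump_code \<le>\<^sup>*\<^sub>s\<^sub>W Q.jump_code"
  shows "P \<le>\<^sub>f\<^sub>i\<^sub>n Q"
proof (rule finite_reducible_jumpD, rule finite_reducible_of_coded)
  show "coded (\<lambda>f s. c (f s)) (\<lambda>y. nat_code (d y)) (jump P) \<le>\<^sup>*\<^sub>s\<^sub>W
      coded (\<lambda>f s. c' (f s)) (\<lambda>y. nat_code (d' y)) (jump Q)"
    using assms unfolding P.jump_code_def Q.jump_code_def .
  show "inj_on (\<lambda>y. nat_code (d y)) (all_solutions (jump P))"
    by (rule inj_on_nat_code_comp[OF inj_on_subset[OF P.inj_solutions all_solutions_jump]])
qed (intro inj_on_seq_code P.inj_instances Q.inj_instances)+

text \<open>One pair of functionals serves both the finite problems and their jumps: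
  \<open>F\<close> acts termwise, and the code of a single instance is a constant sequence.\<close>

lemma turing_realizers:
  assumes "P \<le>\<^sub>f\<^sub>i\<^sub>n Q"
  obtains F G \<phi> \<psi> where "turing_functional F" "turing_functional G"
    "\<forall>x\<in>instances P. \<phi> x \<in> instances Q"
    "\<forall>x\<in>instances P. \<forall>y\<in>solutions Q (\<phi> x). \<psi> y \<in> solutions P x"
    "\<forall>f. (\<forall>s. f s \<in> instances P) \<longrightarrow> F (\<lambda>s. c (f s)) = Some (\<lambda>s. c' (\<phi> (f s)))"
    "\<forall>y\<in>all_solutions Q. G (nat_code (d' y)) = Some (nat_code (d (\<psi> y)))"
proof -
  from assms obtain \<phi> \<psi> where red: "\<forall>x\<in>instances P. \<phi> x \<in> instances Q \<and>
      (\<forall>y\<in>solutions Q (\<phi> x). \<exists>z. \<psi> y = Some z \<and> z \<in> solutions P x)"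
    unfolding finite_reducible_def by blast
  obtain F where F: "turing_functional F"
    "\<And>f. (\<And>s. f s \<in> instances P) \<Longrightarrow> F (\<lambda>s. c (f s)) = Some (\<lambda>s. c' (\<phi> (f s)))"
    using pointwise_turing_functional[OF P.finite_instances P.inj_instances, of "\<lambda>x. c' (\<phi> x)"] by blast
  \<comment> \<open>The table needs an entry for every solution of \<open>Q\<close>, so the partial
    \<open>\<psi>\<close> is totalized by \<open>the\<close>; on solutions of some
    \<open>\<phi> x\<close> the entry is a correct answer.\<close>
  obtain G where G: "turing_functional G"
    "\<And>f. (\<And>s. f s \<in> all_solutions Q) \<Longrightarrow> G (\<lambda>s. d' (f s)) = Some (\<lambda>s. d (the (\<psi> (f s))))"
    using pointwise_turing_functional[OF Q.finite_all_solutions Q.inj_solutions, of "\<lambda>y. d (the (\<psi> y))"]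
    by blast
  have "G (nat_code (d' y)) = Some (nat_code (d (the (\<psi> y))))" if "y \<in> all_solutions Q" for y
    using G(2)[of "\<lambda>_. y"] that by (simp add: nat_code_def)
  moreover have "\<forall>x\<in>instances P. \<forall>y\<in>solutions Q (\<phi> x). the (\<psi> y) \<in> solutions P x"
    using red by force
  ultimately show ?thesis
    using F G(1) red by (intro that[of F G \<phi> "\<lambda>y. the (\<psi> y)"]) auto
qed

lemma code_reducible:
  assumes "P \<le>\<^sub>f\<^sub>i\<^sub>n Q"
  shows "P.code \<le>\<^sub>s\<^sub>W Q.code"
proof -
  from assms obtain F G \<phi> \<psi> where turing: "turing_functional F" "turing_functional G"
    and \<phi>: "\<forall>x\<in>instances P. \<phi> x \<in> instances Q"
    and \<psi>: "\<forall>x\<in>instances P. \<forall>y\<in>solutions Q (\<phi> x). \<psi> y \<in> solutions P x"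
    and F: "\<forall>f. (\<forall>s. f s \<in> instances P) \<longrightarrow> F (\<lambda>s. c (f s)) = Some (\<lambda>s. c' (\<phi> (f s)))"
    and G: "\<forall>y\<in>all_solutions Q. G (nat_code (d' y)) = Some (nat_code (d (\<psi> y)))"
    by (rule turing_realizers)
  have "\<exists>p'. F p = Some p' \<and> p' \<in> instances Q.code \<and>
      (\<forall>q\<in>solutions Q.code p'. \<exists>r. G q = Some r \<and> r \<in> solutions P.code p)"
    if "p \<in> instances P.code" for p
  proof -
    from that obtain x where x: "x \<in> instances P" and p: "p = nat_code (c x)"
      by (auto simp: P.code_def instances_coded)
    have "F p = Some (nat_code (c' (\<phi> x)))"
      using spec[OF F, of "\<lambda>_. x"] x by (simp add: p nat_code_def)
    moreover have "nat_code (c' (\<phi> x)) \<in> instances Q.code"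
      using bspec[OF \<phi> x] by (simp add: Q.code_def instances_coded)
    moreover have "\<exists>r. G q = Some r \<and> r \<in> solutions P.code p"
      if "q \<in> solutions Q.code (nat_code (c' (\<phi> x)))" for q
      using that G bspec[OF \<psi> x] bspec[OF \<phi> x]
      by (auto simp: p P.solutions_code[OF x] Q.solutions_code[OF bspec[OF \<phi> x]] all_solutions_def)
    ultimately show ?thesis by blast
  qed
  with turing show ?thesis unfolding sW_reducible_def by blast
qed

text \<open>Applying \<open>\<phi>\<close> termwise preserves eventual constancy and maps the limit
  \<open>x\<close> to \<open>\<phi> x\<close>, so the finite reduction lifts with the same backward
  table.\<close>

lemma jump_code_reducible:
  assumes "P \<le>\<^sub>f\<^sub>i\<^sub>n Q"
  shows "P.jump_code \<le>\<^sub>s\<^sub>W Q.jump_code"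
proof -
  from assms obtain F G \<phi> \<psi> where turing: "turing_functional F" "turing_functional G"
    and \<phi>: "\<forall>x\<in>instances P. \<phi> x \<in> instances Q"
    and \<psi>: "\<forall>x\<in>instances P. \<forall>y\<in>solutions Q (\<phi> x). \<psi> y \<in> solutions P x"
    and F: "\<forall>f. (\<forall>s. f s \<in> instances P) \<longrightarrow> F (\<lambda>s. c (f s)) = Some (\<lambda>s. c' (\<phi> (f s)))"
    and G: "\<forall>y\<in>all_solutions Q. G (nat_code (d' y)) = Some (nat_code (d (\<psi> y)))"
    by (rule turing_realizers)
  have "\<exists>p'. F p = Some p' \<and> p' \<in> instances Q.jump_code \<and>
      (\<forall>q\<in>solutions Q.jump_code p'. \<exists>r. G q = Some r \<and> r \<in> solutions P.jump_code p)"
    if "p \<in> instances P.jump_code" for p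
  proof -
    from that obtain f where f: "f \<in> instances (jump P)" and p: "p = (\<lambda>s. c (f s))"
      by (auto simp: P.jump_code_def instances_coded)
    then have fP: "f s \<in> instances P" for s by (simp add: jump_def)
    from f obtain x where x: "x \<in> instances P" and lim: "\<forall>\<^sub>F s in sequentially. f s = x"
      and sol: "solutions (jump P) f = solutions P x"
      by (rule jump_instance_limit)
    from lim have lim': "\<forall>\<^sub>F s in sequentially. \<phi> (f s) = \<phi> x" by eventually_elim simp
    then have f': "(\<lambda>s. \<phi> (f s)) \<in> instances (jump Q)"
      using \<phi> fP by (auto simp: jump_def)
    have sol': "solutions (jump Q) (\<lambda>s. \<phi> (f s)) = solutions Q (\<phi> x)"
      by (rule solutions_jump) (rule lim')
    have "F p = Some (\<lambda>s. c' (\<phi> (f s)))" using F fP by (simp add: p)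
    moreover have "(\<lambda>s. c' (\<phi> (f s))) \<in> instances Q.jump_code"
      using f' by (auto simp: Q.jump_code_def instances_coded image_iff)
    moreover have "\<exists>r. G q = Some r \<and> r \<in> solutions P.jump_code p"
      if "q \<in> solutions Q.jump_code (\<lambda>s. c' (\<phi> (f s)))" for q
      using that G bspec[OF \<psi> x] bspec[OF \<phi> x]
      by (auto simp: p P.solutions_jump_code[OF f] Q.solutions_jump_code[OF f'] sol sol'
          all_solutions_def)
    ultimately show ?thesis by blast
  qed
  with turing show ?thesis unfolding sW_reducible_def by blast
qed

end


section \<open>From Weihrauch reductions of jumps to finite reductions\<close>

text \<open>Induction on \<open>Y\<close>, extending the prefix only when some extension makes the
  next value defined. Looking at position 0 is enough for the application, where outputs are
  constant sequences.\<close>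

lemma deciding_prefix:
  assumes \<Psi>: "turing_functional \<Psi>" and "S \<noteq> {}" and "finite Y"
  obtains p N v where "p \<in> S"
    "\<forall>q\<in>S. (\<forall>i<N. q i = p i) \<longrightarrow>
      (\<forall>y\<in>Y. \<forall>r. \<Psi> (baire_pair q (nat_code y)) = Some r \<longrightarrow> r 0 = v y)"
proof -
  define D where "D p N Y v \<longleftrightarrow> (\<forall>q\<in>S. (\<forall>i<N. q i = p i) \<longrightarrow>
      (\<forall>y\<in>Y. \<forall>r. \<Psi> (baire_pair q (nat_code y)) = Some r \<longrightarrow> r 0 = v y))"
    for p and N :: nat and Y and v :: "nat \<Rightarrow> nat"
  have "\<exists>p\<in>S. \<exists>N v. D p N Y v"
    using \<open>finite Y\<close>
  proof induction
    case empty
    obtain p where "p \<in> S" using \<open>S \<noteq> {}\<close> by blast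
    moreover have "D p 0 {} (\<lambda>_. 0)" by (simp add: D_def)
    ultimately show ?case by blast
  next
    case (insert y Y)
    then obtain p N v where p: "p \<in> S" and v: "D p N Y v" by blast
    show ?case
    proof (cases "\<exists>q\<in>S. (\<forall>i<N. q i = p i) \<and> \<Psi> (baire_pair q (nat_code y)) \<noteq> None")
      case True
      then obtain q r where q: "q \<in> S" "\<forall>i<N. q i = p i"
        and r: "\<Psi> (baire_pair q (nat_code y)) = Some r"
        by auto
      from turing_functional_locally_constant[where F = \<Psi> and x = 0, OF \<Psi> r] obtain M where
        M: "\<forall>a. (\<forall>i<M. a i = baire_pair q (nat_code y) i) \<longrightarrow> (\<forall>r'. \<Psi> a = Some r' \<longrightarrow> r' 0 = r 0)"
        unfolding eventually_cylinders by (rule exE)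
      have "D q (max M N) (insert y Y) (v(y := r 0))"
        unfolding D_def
      proof (intro ballI impI allI)
        fix q' y' r'
        assume "q' \<in> S" and agree: "\<forall>i<max M N. q' i = q i" and y': "y' \<in> insert y Y"
          and r': "\<Psi> (baire_pair q' (nat_code y')) = Some r'"
        show "r' 0 = (v(y := r 0)) y'"
        proof (cases "y' = y")
          case True
          \<comment> \<open>Position \<open>i\<close> of the pair reads the first component at most
            at \<open>i div 2\<close>, so agreement below \<open>M\<close> is enough.\<close>
          have "\<forall>i<M. baire_pair q' (nat_code y) i = baire_pair q (nat_code y) i"
            using agree by (auto simp: baire_pair_def)
          with M r' True show ?thesis by simp
        next
          case False
          \<comment> \<open>The new prefix extends the old one, so earlier decisions
            persist.\<close>
          have "\<forall>i<N. q' i = p i" using agree q(2) by simp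
          with v \<open>q' \<in> S\<close> r' y' False have "r' 0 = v y'" unfolding D_def by blast
          with False show ?thesis by simp
        qed
      qed
      with q(1) show ?thesis by blast
    next
      case False
      \<comment> \<open>No extension in \<open>S\<close> makes the value at \<open>y\<close>
        defined, so the condition for \<open>y\<close> is vacuous and \<open>v y\<close> may remain
        arbitrary.\<close>
      have "D p N (insert y Y) v"
        unfolding D_def
      proof (intro ballI impI allI)
        fix q' y' r'
        assume *: "q' \<in> S" "\<forall>i<N. q' i = p i" "y' \<in> insert y Y"
          "\<Psi> (baire_pair q' (nat_code y')) = Some r'"
        with False have "y' \<in> Y" by auto
        with v * show "r' 0 = v y'" unfolding D_def by blast
      qed
      with p show ?thesis by blast
    qed
  qed
  then obtain p N v where "p \<in> S" "D p N Y v" by blast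
  then show ?thesis unfolding D_def by (rule that)
qed

context numbered_problems
begin

lemma finite_reducible_of_W_jump:
  assumes "P.jump_code \<le>\<^sub>W Q.jump_code"
  shows "P \<le>\<^sub>f\<^sub>i\<^sub>n Q"
proof (cases "instances P = {}")
  case True
  then show ?thesis by (simp add: finite_reducible_def)
next
  case False
  from assms obtain \<Phi> \<Psi> where \<Psi>: "turing_functional \<Psi>"
    and red: "\<forall>p\<in>instances P.jump_code. \<exists>p'. \<Phi> p = Some p' \<and> p' \<in> instances Q.jump_code \<and>
      (\<forall>q\<in>solutions Q.jump_code p'. \<exists>r. \<Psi> (baire_pair p q) = Some r \<and>
        r \<in> solutions P.jump_code p)"
    unfolding W_reducible_def by blast
  from False obtain x\<^sub>0 where "x\<^sub>0 \<in> instances P" by blast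
  from const_in_jump[OF this] have ne: "instances P.jump_code \<noteq> {}"
    by (auto simp: P.jump_code_def instances_coded)
  have fin: "finite (d' ` all_solutions Q)" using Q.finite_all_solutions by simp
  from \<Psi> ne fin obtain p N v where p_inst: "p \<in> instances P.jump_code"
    and v: "\<forall>q\<in>instances P.jump_code. (\<forall>i<N. q i = p i) \<longrightarrow> (\<forall>y\<in>d' ` all_solutions Q.
      \<forall>r. \<Psi> (baire_pair q (nat_code y)) = Some r \<longrightarrow> r 0 = v y)"
    by (rule deciding_prefix)
  from p_inst obtain f where f: "f \<in> instances (jump P)" and p: "p = (\<lambda>s. c (f s))"
    by (auto simp: P.jump_code_def instances_coded)
  \<comment> \<open>This map is fixed before any instance \<open>x\<close> is given. Where
    \<open>v\<close> is arbitrary its value is junk, but on solutions that the reduction meets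
    \<open>\<Psi>\<close> is defined and forces \<open>v\<close>.\<close>
  define \<psi> where "\<psi> y = Some (inv_into (all_solutions P) d (v (d' y)))" for y
  have "\<exists>x'. x' \<in> instances Q \<and> (\<forall>y\<in>solutions Q x'. \<exists>z. \<psi> y = Some z \<and> z \<in> solutions P x)"
    if x: "x \<in> instances P" for x
  proof -
    \<comment> \<open>The sequence shares the deciding prefix with \<open>f\<close> but has limit
      \<open>x\<close>, so its solutions are those of \<open>x\<close>.\<close>
    define g where "g s = (if s < N then f s else x)" for s
    have lim: "\<forall>\<^sub>F s in sequentially. g s = x"
      unfolding eventually_sequentially g_def by (rule exI[of _ N]) simp
    have "g s \<in> instances P" for s using f x by (simp add: jump_def g_def)
    with lim have g: "g \<in> instances (jump P)" by (auto simp: jump_def)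
    have sol: "solutions (jump P) g = solutions P x" using lim by (rule solutions_jump)
    have gS: "(\<lambda>s. c (g s)) \<in> instances P.jump_code"
      using g by (auto simp: P.jump_code_def instances_coded)
    from bspec[OF red gS] obtain p' where p': "p' \<in> instances Q.jump_code"
      and r: "\<forall>q\<in>solutions Q.jump_code p'. \<exists>r. \<Psi> (baire_pair (\<lambda>s. c (g s)) q) = Some r \<and>
        r \<in> solutions P.jump_code (\<lambda>s. c (g s))"
      by blast
    from p' obtain h where h: "h \<in> instances (jump Q)" and p'_eq: "p' = (\<lambda>s. c' (h s))"
      by (auto simp: Q.jump_code_def instances_coded)
    from h obtain x' where x': "x' \<in> instances Q" "solutions (jump Q) h = solutions Q x'"
      by (rule jump_instance_limit)
    have "\<exists>z. \<psi> y = Some z \<and> z \<in> solutions P x" if y: "y \<in> solutions Q x'" for y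
    proof -
      obtain z where z: "z \<in> solutions P x"
        "\<Psi> (baire_pair (\<lambda>s. c (g s)) (nat_code (d' y))) = Some (nat_code (d z))"
        using r y by (auto simp: p'_eq Q.solutions_jump_code[OF h] x'(2) P.solutions_jump_code[OF g] sol)
      have "y \<in> all_solutions Q" using y x' by (auto simp: all_solutions_def)
      moreover have "\<forall>i<N. c (g i) = p i" by (simp add: p g_def)
      ultimately have "nat_code (d z) 0 = v (d' y)" using bspec[OF v gS] z(2) by simp
      then have "v (d' y) = d z" by (simp add: nat_code_def)
      moreover have "z \<in> all_solutions P" using z x by (auto simp: all_solutions_def)
      ultimately show ?thesis using z by (simp add: \<psi>_def inv_into_f_f[OF P.inj_solutions])
    qed
    with x'(1) show ?thesis by blast
  qed
  then show ?thesis unfolding finite_reducible_def by meson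
qed

lemma code_reducible_iff:
  "P.code \<le>\<^sup>*\<^sub>s\<^sub>W Q.code \<longleftrightarrow> P \<le>\<^sub>f\<^sub>i\<^sub>n Q"
  "P.code \<le>\<^sub>s\<^sub>W Q.code \<longleftrightarrow> P \<le>\<^sub>f\<^sub>i\<^sub>n Q"
  using finite_reducible_of_code code_reducible sW_reducible_imp_continuous[of P.code Q.code]
  by argo+

text \<open>A cycle: a finite reduction yields a strong one, which yields a continuous and a
  Weihrauch one, and either of these gives back a finite reduction.\<close>

lemma jump_code_reducible_iff:
  "P.jump_code \<le>\<^sup>*\<^sub>s\<^sub>W Q.jump_code \<longleftrightarrow> P \<le>\<^sub>f\<^sub>i\<^sub>n Q"
  "P.jump_code \<le>\<^sub>s\<^sub>W Q.jump_code \<longleftrightarrow> P \<le>\<^sub>f\<^sub>i\<^sub>n Q"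
  "P.jump_code \<le>\<^sub>W Q.jump_code \<longleftrightarrow> P \<le>\<^sub>f\<^sub>i\<^sub>n Q"
  using finite_reducible_of_jump_code finite_reducible_of_W_jump jump_code_reducible
    sW_reducible_imp_continuous[of P.jump_code Q.jump_code]
    sW_reducible_imp_W[of P.jump_code Q.jump_code]
  by argo+

end


section \<open>The pigeonhole and limit problems\<close>

lemma lim_eq_if_eventually_const:
  fixes p :: "nat \<Rightarrow> nat"
  assumes "\<forall>\<^sub>F s in sequentially. p s = a"
  shows "convergent p" "lim p = a"
proof -
  from assms have "p \<longlonglongrightarrow> a" by (simp add: tendsto_discrete)
  then show "convergent p" "lim p = a" by (auto simp: convergent_def limI)
qed

lemma eventually_eq_lim:
  fixes p :: "nat \<Rightarrow> nat"
  assumes "convergent p"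
  shows "\<forall>\<^sub>F s in sequentially. p s = lim p"
  using assms by (simp add: convergent_LIMSEQ_iff tendsto_discrete)

text \<open>The finitely many coordinates stabilize simultaneously. The limit is restricted to
  \<open>{..<m}\<close> because instances are \<open>undefined\<close> elsewhere.\<close>

lemma PHP_jump_eventually_const:
  assumes "f \<in> instances (PHP_jump m n)"
  shows "\<forall>\<^sub>F s in sequentially. f s = (\<lambda>i\<in>{..<m}. lim (\<lambda>s. f s i))"
proof -
  define l where "l i = lim (\<lambda>s. f s i)" for i
  have "\<forall>\<^sub>F s in sequentially. f s i = l i" if "i \<in> {..<m}" for i
    unfolding l_def using that assms by (intro eventually_eq_lim) (auto simp: PHP_jump_def)
  then have "\<forall>\<^sub>F s in sequentially. \<forall>i\<in>{..<m}. f s i = l i"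
    by (intro eventually_ball_finite) auto
  then have "\<forall>\<^sub>F s in sequentially. f s = (\<lambda>i\<in>{..<m}. l i)"
  proof eventually_elim
    case (elim s)
    have "f s \<in> {..<m} \<rightarrow>\<^sub>E {..<n}" using assms by (simp add: PHP_jump_def)
    then have "f s i = undefined" if "i \<notin> {..<m}" for i using that by (rule PiE_arb)
    with elim show ?case by (intro ext) simp
  qed
  then show ?thesis by (simp only: l_def)
qed

lemma instances_PHP_jump: "instances (PHP_jump m n) = instances (jump (PHP m n))"
proof (intro equalityI subsetI)
  fix f assume "f \<in> instances (PHP_jump m n)"
  then show "f \<in> instances (jump (PHP m n))"
    using PHP_jump_eventually_const by (auto simp: PHP_jump_def jump_def PHP_def)
next
  fix f assume "f \<in> instances (jump (PHP m n))"
  then obtain g where f: "\<And>s. f s \<in> {..<m} \<rightarrow>\<^sub>E {..<n}" and g: "\<forall>\<^sub>F s in sequentially. f s = g"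
    by (auto simp: jump_def PHP_def)
  have "convergent (\<lambda>s. f s i)" for i
    using g by (intro lim_eq_if_eventually_const(1)[of _ "g i"]) (auto elim: eventually_mono)
  with f show "f \<in> instances (PHP_jump m n)" by (simp add: PHP_jump_def)
qed

lemma solutions_PHP_jump:
  assumes "f \<in> instances (PHP_jump m n)"
  shows "solutions (PHP_jump m n) f = solutions (jump (PHP m n)) f"
proof -
  have "solutions (jump (PHP m n)) f = solutions (PHP m n) (\<lambda>i\<in>{..<m}. lim (\<lambda>s. f s i))"
    by (rule solutions_jump[OF PHP_jump_eventually_const[OF assms]])
  also have "\<dots> = solutions (PHP_jump m n) f"
    by (auto simp: PHP_def PHP_jump_def)
  finally show ?thesis ..
qed

section \<open>Numberings of the concrete problems\<close>

interpretation PHP: numbered_problem "PHP m n" "fun_code m" set_encode for m n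
proof
  show "finite (instances (PHP m n))" by (simp add: PHP_def finite_PiE)
  have sub: "all_solutions (PHP m n) \<subseteq> Pow {..<m}" by (auto simp: all_solutions_def PHP_def)
  then show "finite (all_solutions (PHP m n))" by (rule finite_subset) simp
  show "inj_on (fun_code m) (instances (PHP m n))"
    using inj_on_fun_code by (simp add: PHP_def)
  show "inj_on set_encode (all_solutions (PHP m n))"
    by (rule inj_on_subset[OF inj_on_set_encode]) (use sub in \<open>auto intro: finite_subset[of _ "{..<m}"]\<close>)
qed

interpretation id: numbered_problem "id_problem k" "\<lambda>j. j" "\<lambda>j. j" for k
  by standard (auto simp: id_problem_def all_solutions_def)

text \<open>\<open>id_problem k\<close> uses the numbers from 1 to \<open>k\<close>, but \<open>lim_problem k\<close> those below \<open>k\<close>.\<close>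

interpretation id_shift: numbered_problem "id_problem k" "\<lambda>j. j - 1" "\<lambda>j. j - 1" for k
  by standard (auto simp: id_problem_def all_solutions_def inj_on_def)

lemma coded_PHP_eq: "coded_PHP m n = PHP.code m n"
  by (simp add: coded_PHP_def PHP.code_def)

lemma coded_id_eq: "coded_id k = id.code k"
  by (simp add: coded_id_def id.code_def)

lemma coded_PHP_jump_eq: "coded_PHP_jump m n = PHP.jump_code m n"
  unfolding coded_PHP_jump_def PHP.jump_code_def
  by (rule coded_cong) (simp_all add: instances_PHP_jump[symmetric] solutions_PHP_jump)

section \<open>The limit problem as the jump of the identity problem\<close>

lemma instances_jump_id: "f \<in> instances (jump (id_problem k)) \<longleftrightarrow>
    (\<forall>s. f s \<in> {1..k}) \<and> (\<exists>x. \<forall>\<^sub>F s in sequentially. f s = x)"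
  by (simp add: jump_def id_problem_def)

lemma solutions_jump_id: "y \<in> solutions (jump (id_problem k)) f \<longleftrightarrow>
    (\<forall>\<^sub>F s in sequentially. f s = y)"
  by (auto simp: jump_def id_problem_def)

lemma Suc_in_jump_id:
  assumes "p \<in> instances (lim_problem k)"
  shows "(\<lambda>s. Suc (p s)) \<in> instances (jump (id_problem k))"
    "Suc (lim p) \<in> solutions (jump (id_problem k)) (\<lambda>s. Suc (p s))"
proof -
  have ev: "\<forall>\<^sub>F s in sequentially. p s = lim p"
    using assms by (intro eventually_eq_lim) (simp add: lim_problem_def)
  then show "Suc (lim p) \<in> solutions (jump (id_problem k)) (\<lambda>s. Suc (p s))"
    by (simp add: solutions_jump_id)
  from ev have "\<forall>\<^sub>F s in sequentially. Suc (p s) = Suc (lim p)" by simp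
  then have "\<exists>x. \<forall>\<^sub>F s in sequentially. Suc (p s) = x" by (rule exI)
  then show "(\<lambda>s. Suc (p s)) \<in> instances (jump (id_problem k))"
    using assms by (simp add: instances_jump_id lim_problem_def Suc_le_eq)
qed

lemma pred_in_lim_problem:
  assumes "f \<in> instances (jump (id_problem k))"
  shows "(\<lambda>s. f s - 1) \<in> instances (lim_problem k)"
    and "y \<in> solutions (jump (id_problem k)) f \<Longrightarrow> lim (\<lambda>s. f s - 1) = y - 1"
proof -
  from assms obtain x where f: "\<And>s. f s \<in> {1..k}" and x: "\<forall>\<^sub>F s in sequentially. f s = x"
    by (auto simp: instances_jump_id)
  have "convergent (\<lambda>s. f s - 1)"
    using x by (intro lim_eq_if_eventually_const(1)[of _ "x - 1"]) (auto elim: eventually_mono)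
  moreover have "f s - 1 < k" for s using f[of s] by auto
  ultimately show "(\<lambda>s. f s - 1) \<in> instances (lim_problem k)" by (simp add: lim_problem_def)
  show "lim (\<lambda>s. f s - 1) = y - 1" if "y \<in> solutions (jump (id_problem k)) f"
    using that by (intro lim_eq_if_eventually_const(2)) (auto simp: solutions_jump_id elim: eventually_mono)
qed

text \<open>Adding and subtracting 1 are mutually inverse between sequences below \<open>k\<close>
  and sequences in \<open>{1..k}\<close>. The underlying instances differ, so the coded problems are
  compared directly instead of through \<open>coded_cong\<close>.\<close>

lemma coded_lim_eq: "coded_lim k = id_shift.jump_code k"
proof -
  let ?J = "jump (id_problem k)" and ?L = "lim_problem k"
  have inst: "instances ?L = (\<lambda>f s. f s - 1) ` instances ?J"
  proof (intro equalityI subsetI)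
    fix p assume "p \<in> instances ?L"
    from Suc_in_jump_id(1)[OF this] show "p \<in> (\<lambda>f s. f s - 1) ` instances ?J"
      by (rule rev_image_eqI) simp
  qed (auto intro: pred_in_lim_problem(1)[unfolded One_nat_def])
  have "{nat_code y |x y. x \<in> instances ?L \<and> x = p \<and> y \<in> solutions ?L x} =
      {nat_code (y - 1) |x y. x \<in> instances ?J \<and> (\<lambda>s. x s - 1) = p \<and> y \<in> solutions ?J x}"
    (is "?A = ?B") for p
  proof (intro equalityI subsetI)
    fix r assume "r \<in> ?A"
    then have p: "p \<in> instances ?L" and r: "r = nat_code (lim p)" by (auto simp: lim_problem_def)
    show "r \<in> ?B"
      using Suc_in_jump_id[OF p] r
      by (intro CollectI exI[of _ "\<lambda>s. Suc (p s)"] exI[of _ "Suc (lim p)"]) simp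
  next
    fix r assume "r \<in> ?B"
    then obtain f y where f: "f \<in> instances ?J" "y \<in> solutions ?J f"
      and p: "p = (\<lambda>s. f s - 1)" and r: "r = nat_code (y - 1)"
      by blast
    have "y - 1 \<in> solutions ?L p"
      using pred_in_lim_problem(2)[OF f] by (simp add: lim_problem_def p)
    then show "r \<in> ?A" using pred_in_lim_problem(1)[OF f(1)] r p by blast
  qed
  then show ?thesis
    unfolding coded_lim_def id_shift.jump_code_def coded_def image_ident by (simp only: inst[symmetric])
qed

interpretation id_PHP: numbered_problems
  "id_problem k" "\<lambda>j. j" "\<lambda>j. j" "PHP m n" "fun_code m" set_encode for k m n ..

interpretation lim_PHP: numbered_problems
  "id_problem k" "\<lambda>j. j - 1" "\<lambda>j. j - 1" "PHP m n" "fun_code m" set_encode for k m n ..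

interpretation PHP_PHP: numbered_problems
  "PHP m n" "fun_code m" set_encode "PHP m' n'" "fun_code m'" set_encode for m n m' n' ..

text \<open>The finite relation does not mention numberings, so \<open>id_PHP\<close> and
  \<open>lim_PHP\<close> rewrite all six conditions to the same finite reduction;
  \<open>PHP_PHP\<close> settles the last equivalence.\<close>

theorem theorem3p4:
  shows "(\<forall>m n k :: nat. n < m \<and> 2 \<le> n \<and> 2 \<le> k \<longrightarrow>
            (coded_lim k \<le>\<^sub>W coded_PHP_jump m n \<longleftrightarrow> coded_lim k \<le>\<^sub>s\<^sub>W coded_PHP_jump m n) \<and>
            (coded_lim k \<le>\<^sub>s\<^sub>W coded_PHP_jump m n \<longleftrightarrow> coded_lim k \<le>\<^sup>*\<^sub>s\<^sub>W coded_PHP_jump m n) \<and>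
            (coded_lim k \<le>\<^sup>*\<^sub>s\<^sub>W coded_PHP_jump m n \<longleftrightarrow> coded_id k \<le>\<^sup>*\<^sub>s\<^sub>W coded_PHP m n) \<and>
            (coded_id k \<le>\<^sup>*\<^sub>s\<^sub>W coded_PHP m n \<longleftrightarrow> id_problem k \<le>\<^sub>f\<^sub>i\<^sub>n PHP m n) \<and>
            (id_problem k \<le>\<^sub>f\<^sub>i\<^sub>n PHP m n \<longleftrightarrow> coded_id k \<le>\<^sub>s\<^sub>W coded_PHP m n)) \<and>
         (\<forall>m\<^sub>0 n\<^sub>0 m\<^sub>1 n\<^sub>1 :: nat. n\<^sub>0 < m\<^sub>0 \<and> 2 \<le> n\<^sub>0 \<and> n\<^sub>1 < m\<^sub>1 \<and> 2 \<le> n\<^sub>1 \<longrightarrow>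
            (PHP m\<^sub>0 n\<^sub>0 \<le>\<^sub>f\<^sub>i\<^sub>n PHP m\<^sub>1 n\<^sub>1 \<longleftrightarrow> coded_PHP_jump m\<^sub>0 n\<^sub>0 \<le>\<^sub>W coded_PHP_jump m\<^sub>1 n\<^sub>1))"
  by (simp only: coded_PHP_eq coded_PHP_jump_eq coded_id_eq coded_lim_eq
      id_PHP.code_reducible_iff lim_PHP.jump_code_reducible_iff PHP_PHP.jump_code_reducible_iff simp_thms)

end
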